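(* Let $(X,\tau)$ and $(Y,\gamma)$ be topological spaces. (1) Suppose that for each neighborhood assignment $\phi:X\to\tau$ on $(X,\tau)$ there are a neighborhood assignment $\psi:Y\to\gamma$ on $(Y,\gamma)$ and a compression map $f:(X,\tau)\to(Y,\gamma)$ which connects $\phi$ with $\psi$. If $(Y,\gamma)$ is a $D$-space, then $(X,\tau)$ is also a $D$-space. (2) Suppose that for each neighborhood assignment $\psi:Y\to\gamma$ on $(Y,\gamma)$ there are a neighborhood assignment $\phi:X\to\tau$ on $(X,\tau)$ and an open bijection $f:(X,\tau)\to(Y,\gamma)$ which connects $\phi$ with $\psi$. If $(X,\tau)$ is a $D$-space, then $(Y,\gamma)$ is also a $D$-space.
   Context: A neighborhood assignment on a topological space $(X,\tau)$ is a function $\phi:X\to\tau$ with $x\in\phi(x)$ for all $x\in X$. $(X,\tau)$ is a $D$-space if for every neighborhood assignment $\phi$ on $X$ there is a closed discrete subset $D\subseteq X$ such that $\bigcup_{x\in D}\phi(x)=X$ (discrete: every point of $D$ is isolated in $D$). A compression map is a continuous bijection. A surjection $f:X\to Y$ connects $\phi$ with $\psi$ if $\psi(f(x))=f(\phi(x))$ for each $x\in X$. *)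

theory Defs
  imports "HOL-Analysis.Abstract_Topology"
begin

text \<open>
  Spaces are modelled by the abstract type of topologies, with carrier \<open>topspace X\<close>.
  Functions on a space are HOL functions whose values off the carrier are irrelevant; all
  conditions below are relativised to the carrier.
\<close>

definition neighborhood_assignment :: "'a topology \<Rightarrow> ('a \<Rightarrow> 'a set) \<Rightarrow> bool"
  where "neighborhood_assignment X \<phi> \<longleftrightarrow>
    (\<forall>x \<in> topspace X. openin X (\<phi> x) \<and> x \<in> \<phi> x)"

text \<open>A point \<open>x\<close> is isolated in \<open>D\<close> if \<open>{x}\<close> is open in the subspace \<open>D\<close>.\<close>

definition discrete_subset :: "'a topology \<Rightarrow> 'a set \<Rightarrow> bool"
  where "discrete_subset X D \<longleftrightarrow>
    D \<subseteq> topspace X \<and> (\<forall>x \<in> D. openin (subtopology X D) {x})"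

definition D_space :: "'a topology \<Rightarrow> bool"
  where "D_space X \<longleftrightarrow>
    (\<forall>\<phi>. neighborhood_assignment X \<phi> \<longrightarrow>
      (\<exists>D. closedin X D \<and> discrete_subset X D \<and> (\<Union>x\<in>D. \<phi> x) = topspace X))"

definition compression_map :: "'a topology \<Rightarrow> 'b topology \<Rightarrow> ('a \<Rightarrow> 'b) \<Rightarrow> bool"
  where "compression_map X Y f \<longleftrightarrow>
    continuous_map X Y f \<and> bij_betw f (topspace X) (topspace Y)"

text \<open>Continuity is not part of being an open bijection.\<close>

definition open_bijection :: "'a topology \<Rightarrow> 'b topology \<Rightarrow> ('a \<Rightarrow> 'b) \<Rightarrow> bool"
  where "open_bijection X Y f \<longleftrightarrow>
    open_map X Y f \<and> bij_betw f (topspace X) (topspace Y)"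

definition connects ::
  "'a topology \<Rightarrow> 'b topology \<Rightarrow> ('a \<Rightarrow> 'b) \<Rightarrow> ('a \<Rightarrow> 'a set) \<Rightarrow> ('b \<Rightarrow> 'b set) \<Rightarrow> bool"
  where "connects X Y f \<phi> \<psi> \<longleftrightarrow>
    f ` topspace X = topspace Y \<and> (\<forall>x \<in> topspace X. \<psi> (f x) = f ` \<phi> x)"

end

theory Submission
  imports Defs
begin

text \<open>
  Closed discrete sets pull back along a continuous bijection \<open>f\<close>, and when \<open>f\<close> connects
  \<open>\<phi>\<close> with \<open>\<psi>\<close>, so do the covers they index. This gives (1); (2) is the same
  argument for the inverse of \<open>f\<close>, which is continuous because \<open>f\<close> is open.
\<close>

text \<open>Isolation is phrased with open sets of the ambient space because those can be pulled
  back along a continuous map.\<close>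

lemma discrete_subset_iff:
  "discrete_subset X D \<longleftrightarrow>
    D \<subseteq> topspace X \<and> (\<forall>x\<in>D. \<exists>U. openin X U \<and> U \<inter> D = {x})"
  unfolding discrete_subset_def openin_subtopology by metis

text \<open>If \<open>U\<close> isolates \<open>f x\<close> in \<open>D\<close>, the preimage of
  \<open>U\<close> isolates \<open>x\<close> in the preimage of \<open>D\<close>: any other point in
  both preimages would share the image \<open>f x\<close>, against injectivity.\<close>

lemma discrete_subset_preimage:
  assumes cont: "continuous_map X Y f" and inj: "inj_on f (topspace X)"
    and D: "discrete_subset Y D"
  shows "discrete_subset X {x \<in> topspace X. f x \<in> D}"
  unfolding discrete_subset_iff
proof (intro conjI ballI)
  fix x assume x: "x \<in> {x \<in> topspace X. f x \<in> D}"
  then obtain U where U: "openin Y U" "U \<inter> D = {f x}"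
    using D unfolding discrete_subset_iff by blast
  have "{z \<in> topspace X. f z \<in> U} \<inter> {z \<in> topspace X. f z \<in> D} = {x}"
    using x U(2) inj by (auto dest: inj_onD)
  then show "\<exists>V. openin X V \<and> V \<inter> {z \<in> topspace X. f z \<in> D} = {x}"
    using openin_continuous_map_preimage[OF cont U(1)] by blast
qed auto

text \<open>Stated for a single pair of assignments, since the map and the second assignment may
  change with the first one.\<close>

lemma D_space_pullback:
  assumes D_Y: "D_space Y"
    and \<phi>: "neighborhood_assignment X \<phi>" and \<psi>: "neighborhood_assignment Y \<psi>"
    and f: "compression_map X Y f" and conn: "connects X Y f \<phi> \<psi>"
  shows "\<exists>D. closedin X D \<and> discrete_subset X D \<and> (\<Union>x\<in>D. \<phi> x) = topspace X"
proof -
  have cont: "continuous_map X Y f" and inj: "inj_on f (topspace X)"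
    and surj: "f ` topspace X = topspace Y"
    using f by (auto simp: compression_map_def bij_betw_def)
  obtain D where D: "closedin Y D" "discrete_subset Y D" "(\<Union>y\<in>D. \<psi> y) = topspace Y"
    using D_Y \<psi> unfolding D_space_def by blast
  let ?E = "{x \<in> topspace X. f x \<in> D}"
  have sub: "\<phi> x \<subseteq> topspace X" if "x \<in> topspace X" for x
    using \<phi> that by (auto simp: neighborhood_assignment_def dest: openin_subset)
  have "z \<in> (\<Union>x\<in>?E. \<phi> x)" if z: "z \<in> topspace X" for z
  proof -
    obtain y where y: "y \<in> D" "f z \<in> \<psi> y"
      using D(3) surj z by blast
    \<comment> \<open>The closed set \<open>D\<close> lies in the carrier of \<open>Y\<close>, so by
      surjectivity its point \<open>y\<close> has a preimage, which then belongs to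
      \<open>?E\<close>.\<close>
    obtain x where x: "x \<in> topspace X" "y = f x"
      using y(1) closedin_subset[OF D(1)] surj by blast
    have "f z \<in> f ` \<phi> x"
      using conn x y(2) by (auto simp: connects_def)
    then have "z \<in> \<phi> x"
      using inj_on_image_mem_iff[OF inj z sub[OF x(1)]] by simp
    then show ?thesis
      using x y(1) by blast
  qed
  then have "(\<Union>x\<in>?E. \<phi> x) = topspace X"
    using sub by blast
  then show ?thesis
    using closedin_continuous_map_preimage[OF cont D(1)]
      discrete_subset_preimage[OF cont inj D(2)] by blast
qed

text \<open>The preimage of an open set under the inverse is its image under \<open>f\<close>, which
  is open because \<open>f\<close> is an open map.\<close>

lemma compression_map_inverse:
  assumes "open_bijection X Y f"
  shows "compression_map Y X (inv_into (topspace X) f)"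
proof -
  let ?g = "inv_into (topspace X) f"
  have op: "open_map X Y f" and bij: "bij_betw f (topspace X) (topspace Y)"
    using assms by (auto simp: open_bijection_def)
  have bij': "bij_betw ?g (topspace Y) (topspace X)"
    using bij by (rule bij_betw_inv_into)
  have "openin Y {y \<in> topspace Y. ?g y \<in> U}" if U: "openin X U" for U
  proof -
    have "{y \<in> topspace Y. ?g y \<in> U} = f ` U"
      using bij openin_subset[OF U]
      by (auto simp: bij_betw_def f_inv_into_f image_iff subset_iff) (metis f_inv_into_f)
    then show ?thesis
      using op U by (simp add: open_map_def)
  qed
  then show ?thesis
    using bij' by (auto simp: compression_map_def continuous_map_def bij_betw_def)
qed

lemma connects_inverse:
  assumes bij: "bij_betw f (topspace X) (topspace Y)"
    and \<phi>: "neighborhood_assignment X \<phi>" and conn: "connects X Y f \<phi> \<psi>"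
  shows "connects Y X (inv_into (topspace X) f) \<psi> \<phi>"
  unfolding connects_def
proof (intro conjI ballI)
  let ?g = "inv_into (topspace X) f"
  show "?g ` topspace Y = topspace X"
    using bij_betw_inv_into[OF bij] by (simp add: bij_betw_def)
  then have g: "?g y \<in> topspace X" if "y \<in> topspace Y" for y
    using that by blast
  fix y assume y: "y \<in> topspace Y"
  have "\<psi> y = f ` \<phi> (?g y)"
    using conn g[OF y] bij_betw_inv_into_right[OF bij y] by (metis connects_def)
  moreover have "\<phi> (?g y) \<subseteq> topspace X"
    using \<phi> g[OF y] by (auto simp: neighborhood_assignment_def dest: openin_subset)
  ultimately show "\<phi> (?g y) = ?g ` \<psi> y"
    using bij by (simp add: inv_into_image_cancel bij_betw_def)
qed

theorem theorem3p36:
  fixes X :: "'a topology" and Y :: "'b topology"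
  shows
    "((\<forall>\<phi>. neighborhood_assignment X \<phi> \<longrightarrow>
        (\<exists>\<psi> f. neighborhood_assignment Y \<psi> \<and> compression_map X Y f \<and> connects X Y f \<phi> \<psi>))
      \<longrightarrow> D_space Y \<longrightarrow> D_space X)
    \<and>
     ((\<forall>\<psi>. neighborhood_assignment Y \<psi> \<longrightarrow>
        (\<exists>\<phi> f. neighborhood_assignment X \<phi> \<and> open_bijection X Y f \<and> connects X Y f \<phi> \<psi>))
      \<longrightarrow> D_space X \<longrightarrow> D_space Y)"
proof (intro conjI impI)
  assume "\<forall>\<phi>. neighborhood_assignment X \<phi> \<longrightarrow>
      (\<exists>\<psi> f. neighborhood_assignment Y \<psi> \<and> compression_map X Y f \<and> connects X Y f \<phi> \<psi>)"
    and "D_space Y"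
  then show "D_space X"
    unfolding D_space_def[of X] by (meson D_space_pullback)
next
  assume H: "\<forall>\<psi>. neighborhood_assignment Y \<psi> \<longrightarrow>
      (\<exists>\<phi> f. neighborhood_assignment X \<phi> \<and> open_bijection X Y f \<and> connects X Y f \<phi> \<psi>)"
    and D_X: "D_space X"
  show "D_space Y"
    unfolding D_space_def
  proof (intro allI impI)
    fix \<psi> assume \<psi>: "neighborhood_assignment Y \<psi>"
    then obtain \<phi> f where \<phi>: "neighborhood_assignment X \<phi>"
      and f: "open_bijection X Y f" and conn: "connects X Y f \<phi> \<psi>"
      using H by blast
    have "connects Y X (inv_into (topspace X) f) \<psi> \<phi>"
      using f \<phi> conn by (intro connects_inverse) (simp_all add: open_bijection_def)
    \<comment> \<open>The roles are swapped: the pullback runs along the inverse from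
      \<open>Y\<close> to \<open>X\<close>, so \<open>X\<close> being a D-space is applied to
      \<open>\<phi>\<close>, and the resulting set is carried back to \<open>Y\<close> to serve
      \<open>\<psi>\<close>.\<close>
    then show "\<exists>D. closedin Y D \<and> discrete_subset Y D \<and> (\<Union>y\<in>D. \<psi> y) = topspace Y"
      using D_space_pullback[OF D_X \<psi> \<phi> compression_map_inverse[OF f]] by blast
  qed
qed

end
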